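(* Let $a$ be an integer with $a\notin\{0,1,-1\}$. Let $\{V_n\}_{n\geq0}$ be defined by $V_0=2$, $V_1=a+2$, $V_{n+1}=(a+2)V_n-(a^2+a+1)V_{n-1}$ for $n\geq1$, and $\{v_n\}_{n\geq0}$ by $v_0=2$, $v_1=2-a$, $v_{n+1}=(2-a)v_n-(a^2-a+1)v_{n-1}$ for $n\geq1$. Then for all $n\geq1$: $$\Delta_6(0,n)=V_n+v_n,$$ $$\Delta_6(1,n)=-\tfrac1aV_n+\tfrac{a^2+a+1}{a}V_{n-1}-\tfrac1av_n+\tfrac{a^2-a+1}{a}v_{n-1},$$ $$\Delta_6(2,n)=-\tfrac{a+1}{a}V_n+\tfrac{a^2+a+1}{a}V_{n-1}-\tfrac{a-1}{a}v_n-\tfrac{a^2-a+1}{a}v_{n-1},$$ $$\Delta_6(3,n)=-V_n+v_n,$$ $$\Delta_6(4,n)=\tfrac1aV_n-\tfrac{a^2+a+1}{a}V_{n-1}-\tfrac1av_n+\tfrac{a^2-a+1}{a}v_{n-1},$$ $$\Delta_6(5,n)=\tfrac{a+1}{a}V_n-\tfrac{a^2+a+1}{a}V_{n-1}-\tfrac{a-1}{a}v_n-\tfrac{a^2-a+1}{a}v_{n-1}.$$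
   Context: For integers $n>0$ and $r$, $\Delta_6(r,n)=6\sum_{0\le k\le n,\ k\equiv r\ (\mathrm{mod}\ 6)}\binom nk a^k-(1+a)^n-(-1)^r(1-a)^n$. *)

theory Defs
  imports Complex_Main "HOL-Number_Theory.Cong"
begin

text \<open>The conditional expression is the sign $(-1)^r$ for an arbitrary integer $r$.\<close>

definition Delta6 :: "int \<Rightarrow> int \<Rightarrow> nat \<Rightarrow> int" where
  "Delta6 a r n =
     6 * (\<Sum>k \<in> {k. k \<le> n \<and> [int k = r] (mod 6)}. int (n choose k) * a ^ k)
     - (1 + a) ^ n - (if even r then 1 else - 1) * (1 - a) ^ n"

end

theory Submission
  imports Defs
begin

text \<open>
  Pascal's rule gives $\Delta_6(r, n+1) = \Delta_6(r, n) + a \Delta_6(r-1, n)$, where $r$ matters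
  only modulo 6. Cleared of the denominator $a$, the six claimed formulas satisfy the same
  recurrence, and they agree with $\Delta_6$ at $n = 1$.
\<close>

text \<open>Pascal's rule, applied termwise after splitting off \<open>k = 0\<close>. An arbitrary
  predicate \<open>P\<close> lets the index shift appear as \<open>P (Suc k)\<close>, which for a
  congruence condition means lowering the residue by one.\<close>

lemma sum_binomial_filter_Suc:
  fixes x :: "'a::comm_semiring_1"
  shows "(\<Sum>k | k \<le> Suc n \<and> P k. of_nat (Suc n choose k) * x ^ k) =
    (\<Sum>k | k \<le> n \<and> P k. of_nat (n choose k) * x ^ k) +
    x * (\<Sum>k | k \<le> n \<and> P (Suc k). of_nat (n choose k) * x ^ k)"
proof -
  have filter: "(\<Sum>k | k \<le> m \<and> Q k. f k) = (\<Sum>k\<le>m. if Q k then f k else 0)"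
    for m Q and f :: "nat \<Rightarrow> 'a"
    using sum.inter_filter[of "{..m}" f Q] by simp
  let ?g = "\<lambda>k. if P k then of_nat (n choose k) * x ^ k else 0"
  have "(\<Sum>k\<le>Suc n. if P k then of_nat (Suc n choose k) * x ^ k else 0) =
      (if P 0 then 1 else 0) +
      (\<Sum>k\<le>n. ?g (Suc k) + x * (if P (Suc k) then of_nat (n choose k) * x ^ k else 0))"
    by (subst sum.atMost_Suc_shift, intro arg_cong2[where f = "(+)"] sum.cong)
      (auto simp: algebra_simps)
  \<comment> \<open>The same shift read backwards, which makes the range of \<open>?g\<close> end at
    \<open>Suc n\<close>. The surplus top term vanishes because \<open>n choose Suc n\<close> is
    0.\<close>
  also have "\<dots> = (\<Sum>k\<le>Suc n. ?g k) +
      x * (\<Sum>k\<le>n. if P (Suc k) then of_nat (n choose k) * x ^ k else 0)"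
    by (subst sum.atMost_Suc_shift) (simp add: sum.distrib sum_distrib_left add.assoc)
  finally show ?thesis
    by (simp add: filter binomial_eq_0)
qed

text \<open>The two subtracted powers obey the same recurrence as the binomial sum:
  \<open>1 + a\<close> splits directly, and in \<open>1 - a\<close> the minus sign is absorbed by
  the parity change from \<open>r\<close> to \<open>r - 1\<close>.\<close>

lemma Delta6_Suc: "Delta6 a r (Suc n) = Delta6 a r n + a * Delta6 a (r - 1) n"
proof -
  have "[int (Suc k) = r] (mod 6) \<longleftrightarrow> [int k = r - 1] (mod 6)" for k
    by (simp add: cong_iff_dvd_diff algebra_simps)
  then show ?thesis
    using sum_binomial_filter_Suc[where n = n and P = "\<lambda>k. [int k = r] (mod 6)" and x = a]
    by (simp add: Delta6_def algebra_simps)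
qed

text \<open>The sign is also determined by \<open>r\<close> modulo 6, since 6 is even. This allows
  the residue \<open>- 1\<close> to be replaced by 5, closing the recurrence on six
  residues.\<close>

lemma Delta6_cong:
  assumes "[r = s] (mod 6)"
  shows "Delta6 a r n = Delta6 a s n"
proof -
  have "even r = even s"
    using assms by (metis cong_dvd_iff cong_dvd_modulus dvd_triv_left mult_2 numeral_Bit0)
  moreover have "[int k = r] (mod 6) \<longleftrightarrow> [int k = s] (mod 6)" for k
    using assms cong_sym cong_trans by blast
  ultimately show ?thesis
    by (simp add: Delta6_def)
qed

lemma Delta6_0:
  assumes "r \<in> {0..<6}"
  shows "Delta6 a r 0 = 6 * of_bool (r = 0) - 1 - (if even r then 1 else - 1)"
proof -
  have "{k. k \<le> (0::nat) \<and> [int k = r] (mod 6)} = (if r = 0 then {0} else {})"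
    using assms by (auto simp: cong_def)
  then show ?thesis
    by (simp add: Delta6_def)
qed

theorem theorem6p1:
  fixes a :: int and V v :: "nat \<Rightarrow> int"
  assumes "a \<notin> {0, 1, - 1}"
    and "V 0 = 2" and "V 1 = a + 2"
    and "\<And>n. n \<ge> 1 \<Longrightarrow> V (n + 1) = (a + 2) * V n - (a\<^sup>2 + a + 1) * V (n - 1)"
    and "v 0 = 2" and "v 1 = 2 - a"
    and "\<And>n. n \<ge> 1 \<Longrightarrow> v (n + 1) = (2 - a) * v n - (a\<^sup>2 - a + 1) * v (n - 1)"
  shows "\<forall>n\<ge>1.
      Delta6 a 0 n = V n + v n \<and>
      rat_of_int (Delta6 a 1 n) =
        - (1 / of_int a) * of_int (V n) + of_int (a\<^sup>2 + a + 1) / of_int a * of_int (V (n - 1))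
        - 1 / of_int a * of_int (v n) + of_int (a\<^sup>2 - a + 1) / of_int a * of_int (v (n - 1)) \<and>
      rat_of_int (Delta6 a 2 n) =
        - (of_int (a + 1) / of_int a) * of_int (V n) + of_int (a\<^sup>2 + a + 1) / of_int a * of_int (V (n - 1))
        - of_int (a - 1) / of_int a * of_int (v n) - of_int (a\<^sup>2 - a + 1) / of_int a * of_int (v (n - 1)) \<and>
      Delta6 a 3 n = - V n + v n \<and>
      rat_of_int (Delta6 a 4 n) =
        1 / of_int a * of_int (V n) - of_int (a\<^sup>2 + a + 1) / of_int a * of_int (V (n - 1))
        - 1 / of_int a * of_int (v n) + of_int (a\<^sup>2 - a + 1) / of_int a * of_int (v (n - 1)) \<and>
      rat_of_int (Delta6 a 5 n) =
        of_int (a + 1) / of_int a * of_int (V n) - of_int (a\<^sup>2 + a + 1) / of_int a * of_int (V (n - 1))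
        - of_int (a - 1) / of_int a * of_int (v n) - of_int (a\<^sup>2 - a + 1) / of_int a * of_int (v (n - 1))"
proof -
  have a0: "a \<noteq> 0"
    using assms(1) by simp
  have D5: "Delta6 a (- 1) n = Delta6 a 5 n" for n
    by (rule Delta6_cong) (simp add: cong_def)
  have step:
    "Delta6 a 0 (Suc n) = Delta6 a 0 n + a * Delta6 a 5 n"
    "Delta6 a 1 (Suc n) = Delta6 a 1 n + a * Delta6 a 0 n"
    "Delta6 a 2 (Suc n) = Delta6 a 2 n + a * Delta6 a 1 n"
    "Delta6 a 3 (Suc n) = Delta6 a 3 n + a * Delta6 a 2 n"
    "Delta6 a 4 (Suc n) = Delta6 a 4 n + a * Delta6 a 3 n"
    "Delta6 a 5 (Suc n) = Delta6 a 5 n + a * Delta6 a 4 n" for n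
    by (simp_all add: Delta6_Suc D5)
  have Vrec: "V (Suc (Suc n)) = (a + 2) * V (Suc n) - (a\<^sup>2 + a + 1) * V n" for n
    using assms(4)[of "Suc n"] by simp
  have vrec: "v (Suc (Suc n)) = (2 - a) * v (Suc n) - (a\<^sup>2 - a + 1) * v n" for n
    using assms(7)[of "Suc n"] by simp
  \<comment> \<open>Residue \<open>r\<close> draws on residue \<open>r - 1\<close>, so all six
    formulas go through one simultaneous induction. Indexing by \<open>Suc n\<close> turns the
    predecessor \<open>n - 1\<close> of the claim into \<open>n\<close>.\<close>
  have main:
    "Delta6 a 0 (Suc n) = V (Suc n) + v (Suc n) \<and>
     a * Delta6 a 1 (Suc n) = - V (Suc n) + (a\<^sup>2 + a + 1) * V n
       - v (Suc n) + (a\<^sup>2 - a + 1) * v n \<and>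
     a * Delta6 a 2 (Suc n) = - (a + 1) * V (Suc n) + (a\<^sup>2 + a + 1) * V n
       - (a - 1) * v (Suc n) - (a\<^sup>2 - a + 1) * v n \<and>
     Delta6 a 3 (Suc n) = - V (Suc n) + v (Suc n) \<and>
     a * Delta6 a 4 (Suc n) = V (Suc n) - (a\<^sup>2 + a + 1) * V n
       - v (Suc n) + (a\<^sup>2 - a + 1) * v n \<and>
     a * Delta6 a 5 (Suc n) = (a + 1) * V (Suc n) - (a\<^sup>2 + a + 1) * V n
       - (a - 1) * v (Suc n) - (a\<^sup>2 - a + 1) * v n" for n
  proof (induction n)
    case 0
    show ?case
      \<comment> \<open>One use of \<open>step\<close> brings the case of exponent 1 down to the
        explicit values at exponent 0.\<close>
      using assms(2,3,5,6)
      by (simp add: step Delta6_0) (simp add: algebra_simps power2_eq_square)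
  next
    case (Suc n)
    \<comment> \<open>Distributing in exactly this shape exposes the products
      \<open>a * Delta6 a r (Suc n)\<close> that are the left-hand sides of the induction
      hypothesis.\<close>
    have mult: "a * (x + a * y) = a * x + a * (a * y)" for x y :: int
      by (simp add: algebra_simps)
    show ?case
      unfolding step(1-6)[of "Suc n"] mult
      using Suc.IH by (simp add: Vrec vrec) (simp add: algebra_simps power2_eq_square)
  qed
  have div: "rat_of_int x = of_int y / of_int a" if "a * x = y" for x y
    using a0 that by (auto simp: field_simps)
  show ?thesis
  proof (intro allI impI, goal_cases)
    case (1 n)
    then obtain m where n: "n = Suc m"
      by (cases n) auto
    note M = main[of m, folded n]
    \<comment> \<open>Only residues 1, 2, 4 and 5 need division by \<open>a\<close>; the formulas
      for 0 and 3 are already integral.\<close>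
    note quotients = M[THEN conjunct2, THEN conjunct1, THEN div]
      M[THEN conjunct2, THEN conjunct2, THEN conjunct1, THEN div]
      M[THEN conjunct2, THEN conjunct2, THEN conjunct2, THEN conjunct2, THEN conjunct1, THEN div]
      M[THEN conjunct2, THEN conjunct2, THEN conjunct2, THEN conjunct2, THEN conjunct2, THEN div]
    have "n - 1 = m"
      using n by simp
    then show ?case
      using M a0 unfolding quotients by (intro conjI) (simp_all, simp_all add: field_simps)
  qed
qed

end
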